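(* For every integer $k\ge 0$, $$\frac{\pi}{4}=\arctan\left(\frac{L_{2k+1}}{2}\right)-\arctan\left(\frac{L_{2k+1}-2}{L_{2k+1}+2}\right).$$
   Context: $(L_m)_{m\ge0}$ is the sequence of Lucas numbers: $L_0=2$, $L_1=1$, $L_m=L_{m-1}+L_{m-2}$ for $m\ge2$. *)

theory Defs
  imports Complex_Main
begin

fun lucas :: "nat \<Rightarrow> nat" where
  "lucas 0 = 2"
| "lucas (Suc 0) = 1"
| "lucas (Suc (Suc n)) = lucas (Suc n) + lucas n"

end

theory Submission
  imports Defs
begin

text \<open>The map sending y to (1 + y) / (1 - y) is tangent addition with pi/4 = arctan 1, and its
  inverse sends x to (x - 1) / (x + 1). Hence the two arctangents differ by pi/4 for every x > 0.
  The theorem is the case x = L/2 with L the Lucas number, which \<open>lucas_pos\<close> makes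
  admissible.\<close>

lemma arctan_diff_eq_pi_div_4:
  fixes x :: real
  assumes "x > 0"
  shows "arctan x - arctan ((x - 1) / (x + 1)) = pi / 4"
proof -
  define y where "y = (x - 1) / (x + 1)"
  \<comment> \<open>This bound keeps arctan 1 + arctan y strictly between -pi/2 and pi/2, so
    \<open>arctan_add\<close> holds without a correction by a multiple of pi.\<close>
  have "\<bar>y\<bar> < 1"
    using assms by (auto simp: y_def abs_less_iff field_simps)
  then have "arctan 1 + arctan y = arctan ((1 + y) / (1 - 1 * y))"
    by (intro arctan_add) auto
  also have "(1 + y) / (1 - 1 * y) = x"
    using assms by (simp add: y_def field_simps)
  finally show ?thesis
    by (simp add: y_def arctan_one)
qed

lemma lucas_pos: "lucas n > 0"
  by (induction n rule: lucas.induct) auto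

theorem mainTheorem8:
  fixes k :: nat
  shows "pi / 4 = arctan (real (lucas (2 * k + 1)) / 2)
                - arctan ((real (lucas (2 * k + 1)) - 2) / (real (lucas (2 * k + 1)) + 2))"
proof -
  define L where "L = real (lucas (2 * k + 1))"
  have "L > 0"
    using lucas_pos[of "2 * k + 1"] by (simp add: L_def)
  then have "(L / 2 - 1) / (L / 2 + 1) = (L - 2) / (L + 2)"
    by (simp add: field_simps)
  with \<open>L > 0\<close> have "pi / 4 = arctan (L / 2) - arctan ((L - 2) / (L + 2))"
    using arctan_diff_eq_pi_div_4[of "L / 2"] by simp
  then show ?thesis
    by (simp only: L_def)
qed

end
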